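(* Let $H$ be a complex separable infinite dimensional Hilbert space. Let $\phi: B(H)\to B(H)$ be a *-semigroup endomorphism which is uniformly continuous on every commutative $C^*$-subalgebra of $B(H)$. If $\phi(0)=0$, then $\phi$ is additive, i.e. $\phi(A+B)=\phi(A)+\phi(B)$ for all $A,B\in B(H)$.
   Context: $B(H)$ denotes the algebra of all bounded linear operators on $H$. A *-semigroup endomorphism of $B(H)$ is a map $\phi:B(H)\to B(H)$ (no linearity, additivity, injectivity or surjectivity is assumed) satisfying $\phi(AB)=\phi(A)\phi(B)$ and $\phi(A^* )=\phi(A)^*$ for all $A,B\in B(H)$. Uniform continuity on a commutative $C^*$-subalgebra means that the restriction of $\phi$ to that subalgebra is uniformly continuous with respect to the operator norm. *)

theory Defs
  imports "HOL-Analysis.Analysis"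
begin

section \<open>Complex Hilbert spaces\<close>

class scaleC =
  fixes scaleC :: "complex \<Rightarrow> 'a \<Rightarrow> 'a"  (infixr \<open>*\<^sub>C\<close> 75)

class complex_vector = scaleC + real_vector +
  assumes scaleR_scaleC: "r *\<^sub>R x = complex_of_real r *\<^sub>C x"
    and scaleC_add_right: "a *\<^sub>C (x + y) = a *\<^sub>C x + a *\<^sub>C y"
    and scaleC_add_left: "(a + b) *\<^sub>C x = a *\<^sub>C x + b *\<^sub>C x"
    and scaleC_scaleC: "a *\<^sub>C (b *\<^sub>C x) = (a * b) *\<^sub>C x"
    and scaleC_one: "1 *\<^sub>C x = x"

interpretation complex_vector:
  vector_space "scaleC :: complex \<Rightarrow> 'a \<Rightarrow> 'a::complex_vector"
  by unfold_locales
    (simp_all add: scaleC_add_right scaleC_add_left scaleC_scaleC scaleC_one)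

abbreviation csubspace :: "'a::complex_vector set \<Rightarrow> bool"
  where "csubspace \<equiv> module.subspace scaleC"

abbreviation cspan :: "'a::complex_vector set \<Rightarrow> 'a set"
  where "cspan \<equiv> module.span scaleC"

text \<open>The complex inner product is linear in its first argument. Its real part is the real inner
  product of class \<^class>\<open>real_inner\<close>; thus positive definiteness and the usual relation to the
  norm are inherited from that class (see \<open>norm_eq_sqrt_cinner\<close> and \<open>cinner_self\<close> below).\<close>

class complex_inner = complex_vector + real_inner +
  fixes cinner :: "'a \<Rightarrow> 'a \<Rightarrow> complex"
  assumes cinner_commute: "cinner x y = cnj (cinner y x)"
    and cinner_add_left: "cinner (x + y) z = cinner x z + cinner y z"
    and cinner_scaleC_left: "cinner (c *\<^sub>C x) y = c * cinner x y"
    and Re_cinner: "Re (cinner x y) = inner x y"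

class chilbert_space = complex_inner + complete_space

lemma cinner_self: "cinner x x = complex_of_real ((norm x)\<^sup>2)"
proof (rule complex_eqI)
  show "Re (cinner x x) = Re (complex_of_real ((norm x)\<^sup>2))"
    by (simp add: Re_cinner power2_norm_eq_inner)
  show "Im (cinner x x) = Im (complex_of_real ((norm x)\<^sup>2))"
    using arg_cong[OF cinner_commute[of x x], of Im] by simp
qed

lemma norm_eq_sqrt_cinner: "norm x = sqrt (Re (cinner x x))"
  by (simp add: cinner_self)

lemma norm_scaleC: "norm (c *\<^sub>C x) = cmod c * norm (x :: 'a::complex_inner)"
proof -
  have "cinner (c *\<^sub>C x) (c *\<^sub>C x) = c * cnj c * cinner x x"
    by (metis cinner_commute cinner_scaleC_left complex_cnj_mult mult.assoc)
  then have "complex_of_real ((norm (c *\<^sub>C x))\<^sup>2) = complex_of_real ((cmod c * norm x)\<^sup>2)"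
    unfolding cinner_self complex_norm_square[symmetric] by (simp add: power_mult_distrib)
  then have "(norm (c *\<^sub>C x))\<^sup>2 = (cmod c * norm x)\<^sup>2"
    using of_real_eq_iff by blast
  then show ?thesis
    by (simp add: power2_eq_iff_nonneg)
qed

lemma cinner_add_right: "cinner x (y + z) = cinner x y + cinner x z"
  using cinner_add_left[of y z x] cinner_commute[of x] by (metis complex_cnj_add)

lemma cinner_scaleC_right: "cinner x (c *\<^sub>C y) = cnj c * cinner x y"
  using cinner_scaleC_left[of c y x] cinner_commute[of x] by (metis complex_cnj_mult)

lemma cinner_diff_left: "cinner (x - y) z = cinner x z - cinner y z"
  using cinner_add_left[of "x - y" y z] by simp

lemma Im_cinner: "Im (cinner x y) = - inner (\<i> *\<^sub>C x) y"
  using Re_cinner[of "\<i> *\<^sub>C x" y] by (simp add: cinner_scaleC_left)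

lemma cinner_ext:
  assumes "\<And>x. cinner x y = cinner x z" shows "y = z"
proof -
  have "inner x y = inner x z" for x
    using arg_cong[OF assms[of x], of Re] by (simp add: Re_cinner)
  then show ?thesis using vector_eq_ldot[of y z] by blast
qed

section \<open>The algebra B(H)\<close>

instantiation blinfun :: (real_normed_vector, complex_inner) complex_vector
begin

lift_definition scaleC_blinfun :: "complex \<Rightarrow> ('a \<Rightarrow>\<^sub>L 'b) \<Rightarrow> ('a \<Rightarrow>\<^sub>L 'b)"
  is "\<lambda>c f x. c *\<^sub>C f x"
proof -
  fix c and f :: "'a \<Rightarrow> 'b"
  assume "bounded_linear f"
  moreover have "bounded_linear (\<lambda>x :: 'b. c *\<^sub>C x)"
    by (rule bounded_linear_intro[of _ "cmod c"])
      (simp_all add: scaleC_add_right scaleR_scaleC scaleC_scaleC mult.commute norm_scaleC)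
  ultimately show "bounded_linear (\<lambda>x. c *\<^sub>C f x)"
    by (rule bounded_linear_compose[rotated])
qed

instance
proof
  fix f g :: "'a \<Rightarrow>\<^sub>L 'b" and a b :: complex and r :: real
  show "r *\<^sub>R f = complex_of_real r *\<^sub>C f"
    by (rule blinfun_eqI) (simp add: scaleC_blinfun.rep_eq blinfun.scaleR_left scaleR_scaleC)
  show "a *\<^sub>C (f + g) = a *\<^sub>C f + a *\<^sub>C g"
    by (rule blinfun_eqI) (simp add: scaleC_blinfun.rep_eq blinfun.add_left scaleC_add_right)
  show "(a + b) *\<^sub>C f = a *\<^sub>C f + b *\<^sub>C f"
    by (rule blinfun_eqI) (simp add: scaleC_blinfun.rep_eq blinfun.add_left scaleC_add_left)
  show "a *\<^sub>C (b *\<^sub>C f) = (a * b) *\<^sub>C f"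
    by (rule blinfun_eqI) (simp add: scaleC_blinfun.rep_eq scaleC_scaleC)
  show "1 *\<^sub>C f = f"
    by (rule blinfun_eqI) (simp add: scaleC_blinfun.rep_eq scaleC_one)
qed

end

definition bounded_operators :: "('h::complex_inner \<Rightarrow>\<^sub>L 'h) set"
  where "bounded_operators = {A. \<forall>c x. blinfun_apply A (c *\<^sub>C x) = c *\<^sub>C blinfun_apply A x}"

definition cadjoint :: "('h::complex_inner \<Rightarrow>\<^sub>L 'h) \<Rightarrow> ('h \<Rightarrow>\<^sub>L 'h)"
  where "cadjoint A =
    (THE B. B \<in> bounded_operators \<and>
      (\<forall>x y. cinner (blinfun_apply A x) y = cinner x (blinfun_apply B y)))"

definition star_semigroup_endomorphism ::
    "(('h::complex_inner \<Rightarrow>\<^sub>L 'h) \<Rightarrow> ('h \<Rightarrow>\<^sub>L 'h)) \<Rightarrow> bool"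
  where "star_semigroup_endomorphism \<phi> \<longleftrightarrow>
    (\<forall>A \<in> bounded_operators. \<phi> A \<in> bounded_operators) \<and>
    (\<forall>A \<in> bounded_operators. \<forall>B \<in> bounded_operators. \<phi> (A o\<^sub>L B) = \<phi> A o\<^sub>L \<phi> B) \<and>
    (\<forall>A \<in> bounded_operators. \<phi> (cadjoint A) = cadjoint (\<phi> A))"

text \<open>A subalgebra is not required to contain the identity operator.\<close>

definition commutative_cstar_subalgebra :: "('h::complex_inner \<Rightarrow>\<^sub>L 'h) set \<Rightarrow> bool"
  where "commutative_cstar_subalgebra \<A> \<longleftrightarrow>
    \<A> \<subseteq> bounded_operators \<and> csubspace \<A> \<and> closed \<A> \<and>
    (\<forall>A \<in> \<A>. \<forall>B \<in> \<A>. A o\<^sub>L B \<in> \<A>) \<and>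
    (\<forall>A \<in> \<A>. cadjoint A \<in> \<A>) \<and>
    (\<forall>A \<in> \<A>. \<forall>B \<in> \<A>. A o\<^sub>L B = B o\<^sub>L A)"

definition infinite_dimensional :: "'h::complex_vector itself \<Rightarrow> bool"
  where "infinite_dimensional _ \<longleftrightarrow> \<not> (\<exists>S :: 'h set. finite S \<and> cspan S = UNIV)"

section \<open>Existence of adjoints\<close>

lemma riesz_representation:
  fixes f :: "'h::chilbert_space \<Rightarrow> complex"
  assumes bl: "bounded_linear f" and fC: "\<And>c x. f (c *\<^sub>C x) = c * f x"
  shows "\<exists>z. \<forall>x. f x = cinner x z"
proof (cases "\<forall>x. f x = 0")
  case True
  have "cinner x 0 = 0" for x :: 'h
    using cinner_scaleC_right[of x 0 0] by simp
  with True show ?thesis by metis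
next
  case False
  interpret f: bounded_linear f by (rule bl)
  define M where "M = {x. f x = 1}"
  from False obtain w where "f w \<noteq> 0" by blast
  then have wM: "(1 / f w) *\<^sub>C w \<in> M" by (simp add: M_def fC)
  define d where "d = (INF x\<in>M. (norm x)\<^sup>2)"
  have bdd: "bdd_below ((\<lambda>x. (norm x)\<^sup>2) ` M)" by (rule bdd_belowI2[of _ 0]) simp
  have d_le: "d \<le> (norm x)\<^sup>2" if "x \<in> M" for x
    unfolding d_def using bdd that by (rule cINF_lower)
  have "\<exists>x\<in>M. (norm x)\<^sup>2 < d + 1 / Suc n" for n
    using cINF_less_iff[of M "\<lambda>x. (norm x)\<^sup>2" "d + 1 / Suc n"] wM bdd
    unfolding d_def by auto
  then obtain X where XM: "\<And>n. X n \<in> M" and Xd: "\<And>n. (norm (X n))\<^sup>2 < d + 1 / Suc n"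
    by metis
  have dist: "(norm (x - y))\<^sup>2 \<le> 2 * (norm x)\<^sup>2 + 2 * (norm y)\<^sup>2 - 4 * d"
    if "x \<in> M" "y \<in> M" for x y
  proof -
    have "(1/2) *\<^sub>R (x + y) \<in> M"
      using that by (simp add: M_def f.scaleR f.add scaleR_conv_of_real)
    from d_le[OF this] have "4 * d \<le> (norm (x + y))\<^sup>2"
      by (simp add: power_divide)
    then show ?thesis
      by (simp add: power2_norm_eq_inner inner_add inner_diff inner_commute)
  qed
  have "Cauchy X"
  proof (rule metric_CauchyI)
    fix e :: real assume "e > 0"
    then obtain N where N: "4 / Suc N < e\<^sup>2"
      using reals_Archimedean[of "e\<^sup>2 / 4"] by (auto simp: field_simps)
    have "dist (X m) (X n) < e" if "m \<ge> N" "n \<ge> N" for m n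
    proof -
      have le: "1 / Suc k \<le> 1 / Suc N" if "k \<ge> N" for k
        using that by (simp add: frac_le)
      have "(norm (X m - X n))\<^sup>2 \<le> 2 * (1 / Suc m) + 2 * (1 / Suc n)"
        using dist[OF XM[of m] XM[of n]] Xd[of m] Xd[of n] by linarith
      also have "\<dots> \<le> 4 / Suc N"
        using le[OF that(1)] le[OF that(2)] by linarith
      finally have "(norm (X m - X n))\<^sup>2 < e\<^sup>2" using N by linarith
      then show ?thesis
        using \<open>e > 0\<close> by (simp add: dist_norm power_less_imp_less_base)
    qed
    then show "\<exists>N. \<forall>m\<ge>N. \<forall>n\<ge>N. dist (X m) (X n) < e" by blast
  qed
  then obtain z where z: "X \<longlonglongrightarrow> z"
    using Cauchy_convergent convergent_def by blast
  have zM: "f z = 1"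
    using LIMSEQ_unique[OF f.tendsto[OF z]] XM by (simp add: M_def)
  have "(norm z)\<^sup>2 \<le> d"
  proof (rule LIMSEQ_le)
    show "(\<lambda>n. (norm (X n))\<^sup>2) \<longlonglongrightarrow> (norm z)\<^sup>2" by (intro tendsto_intros z)
    show "(\<lambda>n. d + 1 / Suc n) \<longlonglongrightarrow> d"
      using tendsto_add[OF tendsto_const LIMSEQ_Suc[OF lim_1_over_n]] by simp
  qed (use Xd in \<open>auto intro: less_imp_le\<close>)
  have orth: "cinner y z = 0" if "f y = 0" for y
  proof (cases "y = 0")
    case True
    then show ?thesis using cinner_scaleC_left[of 0 y z] by simp
  next
    case False
    define a where "a = cinner y z"
    define c where "c = - cnj a / complex_of_real ((norm y)\<^sup>2)"
    have cc: "c * complex_of_real ((norm y)\<^sup>2) = - cnj a"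
      using False by (simp add: c_def)
    have "z + c *\<^sub>C y \<in> M" using zM that by (simp add: M_def f.add fC)
    from d_le[OF this] have le: "(norm z)\<^sup>2 \<le> (norm (z + c *\<^sub>C y))\<^sup>2"
      using \<open>(norm z)\<^sup>2 \<le> d\<close> by linarith
    have zy: "cinner z y = cnj a" by (simp add: a_def cinner_commute[of z y])
    have "complex_of_real ((norm (z + c *\<^sub>C y))\<^sup>2)
        = complex_of_real ((norm z)\<^sup>2) + cnj c * cnj a + c * a
          + cnj c * (c * complex_of_real ((norm y)\<^sup>2))"
      unfolding cinner_self[symmetric]
      by (simp add: cinner_add_left cinner_add_right cinner_scaleC_left cinner_scaleC_right
          zy a_def[symmetric] algebra_simps)
    also have "\<dots> = complex_of_real ((norm z)\<^sup>2) + c * a"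
      unfolding cc by simp
    also have "c * a = - complex_of_real ((cmod a)\<^sup>2 / (norm y)\<^sup>2)"
      unfolding of_real_divide complex_norm_square by (simp add: c_def mult.commute)
    finally have "complex_of_real ((norm (z + c *\<^sub>C y))\<^sup>2)
        = complex_of_real ((norm z)\<^sup>2 - (cmod a)\<^sup>2 / (norm y)\<^sup>2)"
      by simp
    then have "(norm (z + c *\<^sub>C y))\<^sup>2 = (norm z)\<^sup>2 - (cmod a)\<^sup>2 / (norm y)\<^sup>2"
      by (simp only: of_real_eq_iff)
    with le have "(cmod a)\<^sup>2 / (norm y)\<^sup>2 \<le> 0" by linarith
    then show ?thesis
      using False by (simp add: a_def divide_le_0_iff)
  qed
  have "z \<noteq> 0" using zM f.zero by auto
  define N where "N = complex_of_real ((norm z)\<^sup>2)"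
  have "N \<noteq> 0" "cnj N = N" using \<open>z \<noteq> 0\<close> by (simp_all add: N_def)
  have "f x = cinner x ((1 / N) *\<^sub>C z)" for x
  proof -
    have "f (x - f x *\<^sub>C z) = 0" by (simp add: f.diff fC zM)
    from orth[OF this] have "cinner x z = f x * N"
      by (simp add: cinner_diff_left cinner_scaleC_left cinner_self N_def)
    then show ?thesis
      using \<open>N \<noteq> 0\<close> \<open>cnj N = N\<close> by (simp add: cinner_scaleC_right)
  qed
  then show ?thesis by blast
qed

lemma bounded_linear_cinner_left: "bounded_linear (\<lambda>x :: 'h::complex_inner. cinner x y)"
proof (rule bounded_linear_intro)
  fix x z :: 'h and r :: real
  show "cinner (x + z) y = cinner x y + cinner z y" by (rule cinner_add_left)
  show "cinner (r *\<^sub>R x) y = r *\<^sub>R cinner x y"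
    by (simp add: scaleR_scaleC cinner_scaleC_left scaleR_conv_of_real)
  have "cmod (cinner x y) \<le> \<bar>Re (cinner x y)\<bar> + \<bar>Im (cinner x y)\<bar>" by (rule cmod_le)
  also have "\<dots> \<le> norm x * norm y + norm (\<i> *\<^sub>C x) * norm y"
    unfolding Re_cinner Im_cinner abs_minus_cancel
    by (intro add_mono Cauchy_Schwarz_ineq2)
  finally show "norm (cinner x y) \<le> norm x * (2 * norm y)"
    by (simp add: norm_scaleC)
qed

lemma cadjoint_exists:
  fixes A :: "'h::chilbert_space \<Rightarrow>\<^sub>L 'h"
  assumes "A \<in> bounded_operators"
  shows "\<exists>!B. B \<in> bounded_operators \<and>
    (\<forall>x y. cinner (blinfun_apply A x) y = cinner x (blinfun_apply B y))"
proof -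
  have "\<exists>z. \<forall>x. cinner (A x) y = cinner x z" for y
    by (rule riesz_representation)
      (use assms in \<open>auto simp: bounded_operators_def cinner_scaleC_left
        intro: bounded_linear_compose[OF bounded_linear_cinner_left] blinfun.bounded_linear_right\<close>)
  then obtain b where b: "\<And>x y. cinner (A x) y = cinner x (b y)" by metis
  have b_scaleC: "b (c *\<^sub>C y) = c *\<^sub>C b y" for c y
    by (rule cinner_ext) (simp add: b[symmetric] cinner_scaleC_right)
  have "bounded_linear b"
  proof (rule bounded_linear_intro)
    fix x y :: 'h and r :: real
    show "b (x + y) = b x + b y"
      by (rule cinner_ext) (simp add: b[symmetric] cinner_add_right)
    show "b (r *\<^sub>R x) = r *\<^sub>R b x" by (simp add: scaleR_scaleC b_scaleC)
    have "(norm (b x))\<^sup>2 = inner (A (b x)) x"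
      by (metis Re_cinner b power2_norm_eq_inner)
    also have "\<dots> \<le> norm (A (b x)) * norm x" by (rule norm_cauchy_schwarz)
    also have "\<dots> \<le> norm A * norm (b x) * norm x"
      by (intro mult_right_mono norm_blinfun) simp
    finally have "norm (b x) * norm (b x) \<le> norm (b x) * (norm x * norm A)"
      by (simp add: power2_eq_square mult_ac)
    then show "norm (b x) \<le> norm x * norm A"
      by (cases "b x = 0") simp_all
  qed
  then have app: "blinfun_apply (Blinfun b) = b" by (rule bounded_linear_Blinfun_apply)
  show ?thesis
  proof (rule ex1I[of _ "Blinfun b"])
    show "Blinfun b \<in> bounded_operators \<and> (\<forall>x y. cinner (A x) y = cinner x (Blinfun b y))"
      by (simp add: app b b_scaleC bounded_operators_def)
  next
    fix B assume B: "(B :: 'h \<Rightarrow>\<^sub>L 'h) \<in> bounded_operators \<and> (\<forall>x y. cinner (A x) y = cinner x (B y))"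
    show "B = Blinfun b"
    proof (rule blinfun_eqI)
      fix y
      show "B y = Blinfun b y"
        unfolding app by (rule cinner_ext) (use B b in metis)
    qed
  qed
qed

lemma
  fixes A :: "'h::chilbert_space \<Rightarrow>\<^sub>L 'h"
  assumes "A \<in> bounded_operators"
  shows cadjoint_in_bounded_operators: "cadjoint A \<in> bounded_operators"
    and cinner_cadjoint: "cinner (A x) y = cinner x (cadjoint A y)"
proof -
  have "cadjoint A \<in> bounded_operators \<and>
      (\<forall>x y. cinner (blinfun_apply A x) y = cinner x (blinfun_apply (cadjoint A) y))"
    unfolding cadjoint_def by (rule theI'[OF cadjoint_exists[OF assms]])
  then show "cadjoint A \<in> bounded_operators" "cinner (A x) y = cinner x (cadjoint A y)"
    by blast+
qed

end

theory Submission
  imports Defs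
begin

text \<open>The endomorphism is additive because multiplicativity turns sums into products as soon as \<open>\<phi>\<close>
  respects the decomposition \<open>I = P + (I - P)\<close> given by an orthogonal projection \<open>P\<close>.

  That decomposition is respected (\<open>orthogonally_additive\<close>) because of uniform continuity on an
  unbounded algebra. The defect \<open>Q = \<phi> I - \<phi> P - \<phi> (I - P)\<close> satisfies
  \<open>Q \<phi> (x P) = Q \<phi> (y (I - P)) = 0\<close>, so \<open>Q \<phi> (x P + y (I - P))\<close> is uniformly small as soon as one of
  the two scalars is small, whatever the other one is. With \<open>(x, y) = (t, 1/t)\<close> and
  \<open>(x, y) = (1/t, t)\<close> the product of the two values is \<open>Q\<close> itself, which is therefore \<open>0\<close>. This
  is where maps such as a power of a determinant are excluded.

  Hence \<open>\<phi>\<close> is the sum of its values on the four corners cut out by \<open>P\<close>. On the off-diagonal corner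
  \<open>P A (I - P)\<close> it is additive (\<open>additive_off_diagonal\<close>) by Martindale's identity
  \<open>A + B = (P + A) ((I - P) + B)\<close>. If \<open>P\<close> is equivalent to a subprojection of \<open>I - P\<close>, multiplication
  by the corresponding partial isometry moves the diagonal corner into the off-diagonal one, and
  \<open>\<phi>\<close> is additive on all of \<open>P B(H)\<close> (\<open>additive_corner\<close>).

  It remains to write \<open>I\<close> as a sum of such projections (\<open>identity_splits\<close>). Zorn's lemma gives a
  maximal partial isometry whose initial and final spaces are orthogonal; its initial and final
  projections are two of the summands, and by maximality what is left has rank at most one, which
  embeds into its complement because \<open>H\<close> has more than one dimension.\<close>

section \<open>Bounded operators and adjoints\<close>

interpretation blinfun_compose: bounded_bilinear "(o\<^sub>L)"
  by (rule bounded_bilinear_blinfun_compose)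

lemma blinfun_compose_assoc: "(A o\<^sub>L B) o\<^sub>L C = A o\<^sub>L (B o\<^sub>L C)"
  by (rule blinfun_eqI) simp

lemma blinfun_compose_id [simp]: "A o\<^sub>L id_blinfun = A" "id_blinfun o\<^sub>L A = A"
  by (rule blinfun_eqI; simp)+

lemma csubspace_bounded_operators:
  "csubspace (bounded_operators :: ('h::complex_inner \<Rightarrow>\<^sub>L 'h) set)"
  unfolding complex_vector.subspace_def bounded_operators_def
  by (auto simp: blinfun.zero_left blinfun.add_left scaleC_blinfun.rep_eq scaleC_add_right
      scaleC_scaleC mult.commute)

lemmas zero_bounded_operators [intro, simp] =
    complex_vector.subspace_0 [OF csubspace_bounded_operators]
  and add_bounded_operators [intro, simp] =
    complex_vector.subspace_add [OF csubspace_bounded_operators]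
  and diff_bounded_operators [intro, simp] =
    complex_vector.subspace_diff [OF csubspace_bounded_operators]
  and scaleC_bounded_operators [intro, simp] =
    complex_vector.subspace_scale [OF csubspace_bounded_operators]

lemma scaleR_bounded_operators [intro, simp]:
  "A \<in> bounded_operators \<Longrightarrow> r *\<^sub>R A \<in> bounded_operators"
  by (simp add: scaleR_scaleC)

lemma id_bounded_operators [intro, simp]: "id_blinfun \<in> bounded_operators"
  by (simp add: bounded_operators_def)

lemma compose_bounded_operators [intro, simp]:
  "A \<in> bounded_operators \<Longrightarrow> B \<in> bounded_operators \<Longrightarrow> A o\<^sub>L B \<in> bounded_operators"
  by (simp add: bounded_operators_def)

lemma bounded_linear_scaleC: "bounded_linear (\<lambda>x :: 'h::complex_inner. c *\<^sub>C x)"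
  by (rule bounded_linear_intro[of _ "cmod c"])
    (simp_all add: scaleC_add_right scaleR_scaleC scaleC_scaleC mult.commute norm_scaleC)

lemma closed_bounded_operators:
  "closed (bounded_operators :: ('h::complex_inner \<Rightarrow>\<^sub>L 'h) set)"
proof -
  have "closed {A :: 'h \<Rightarrow>\<^sub>L 'h. A (c *\<^sub>C x) = c *\<^sub>C A x}" for c x
    by (intro closed_Collect_eq bounded_linear.continuous_on[OF bounded_linear_scaleC]
        continuous_intros)
  then show ?thesis
    unfolding bounded_operators_def by (intro closed_Collect_all)
qed

lemma cadjoint_eqI:
  fixes A :: "'h::chilbert_space \<Rightarrow>\<^sub>L 'h"
  assumes "A \<in> bounded_operators" "B \<in> bounded_operators"
    and "\<And>x y. cinner (A x) y = cinner x (B y)"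
  shows "cadjoint A = B"
  using cadjoint_exists[OF assms(1)] cadjoint_in_bounded_operators[OF assms(1)]
    cinner_cadjoint[OF assms(1)] assms(2,3) by metis

lemma cinner_cadjoint_left:
  fixes A :: "'h::chilbert_space \<Rightarrow>\<^sub>L 'h"
  assumes "A \<in> bounded_operators"
  shows "cinner (cadjoint A x) y = cinner x (A y)"
  using cinner_cadjoint[OF assms, of y x] cinner_commute by metis

lemma cadjoint_cadjoint:
  fixes A :: "'h::chilbert_space \<Rightarrow>\<^sub>L 'h"
  assumes "A \<in> bounded_operators"
  shows "cadjoint (cadjoint A) = A"
  using assms by (intro cadjoint_eqI cadjoint_in_bounded_operators cinner_cadjoint_left)

lemma cadjoint_compose:
  fixes A :: "'h::chilbert_space \<Rightarrow>\<^sub>L 'h"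
  assumes "A \<in> bounded_operators" "B \<in> bounded_operators"
  shows "cadjoint (A o\<^sub>L B) = cadjoint B o\<^sub>L cadjoint A"
  using assms
  by (intro cadjoint_eqI compose_bounded_operators cadjoint_in_bounded_operators)
    (simp_all add: cinner_cadjoint)

section \<open>Commutants\<close>

definition commutant :: "('h::complex_inner \<Rightarrow>\<^sub>L 'h) set \<Rightarrow> ('h \<Rightarrow>\<^sub>L 'h) set"
  where "commutant S = {A \<in> bounded_operators. \<forall>B\<in>S. A o\<^sub>L B = B o\<^sub>L A}"

lemma commutant_subset: "commutant S \<subseteq> bounded_operators"
  by (auto simp: commutant_def)

lemma csubspace_commutant:
  assumes "S \<subseteq> bounded_operators"
  shows "csubspace (commutant S)"
  using assms unfolding complex_vector.subspace_def commutant_def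
  by (auto simp: blinfun_compose.add_left blinfun_compose.add_right bounded_operators_def
      blinfun.add_left scaleC_blinfun.rep_eq scaleC_add_right dest!: subsetD intro!: blinfun_eqI)
    (metis blinfun_apply_blinfun_compose)

lemma closed_commutant: "closed (commutant S)"
proof -
  have "closed {A :: 'a \<Rightarrow>\<^sub>L 'a. A o\<^sub>L B = B o\<^sub>L A}" for B
    by (intro closed_Collect_eq continuous_intros)
  moreover have "commutant S = bounded_operators \<inter> (\<Inter>B\<in>S. {A. A o\<^sub>L B = B o\<^sub>L A})"
    by (auto simp: commutant_def)
  ultimately show ?thesis
    by (auto intro!: closed_Int closed_INT closed_bounded_operators)
qed

lemma compose_commutant:
  assumes "A \<in> commutant S" "B \<in> commutant S"
  shows "A o\<^sub>L B \<in> commutant S"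
proof -
  have "(A o\<^sub>L B) o\<^sub>L C = C o\<^sub>L (A o\<^sub>L B)" if "C \<in> S" for C
  proof -
    have "A o\<^sub>L C = C o\<^sub>L A" "B o\<^sub>L C = C o\<^sub>L B"
      using assms that unfolding commutant_def by blast+
    then show ?thesis
      by (metis blinfun_compose_assoc)
  qed
  then show ?thesis
    using assms unfolding commutant_def by blast
qed

lemma cadjoint_commutant:
  fixes S :: "('h::chilbert_space \<Rightarrow>\<^sub>L 'h) set"
  assumes "S \<subseteq> bounded_operators" "cadjoint ` S \<subseteq> S" "A \<in> commutant S"
  shows "cadjoint A \<in> commutant S"
proof -
  have A: "A \<in> bounded_operators" using assms(3) by (simp add: commutant_def)
  have "cadjoint A o\<^sub>L B = B o\<^sub>L cadjoint A" if "B \<in> S" for B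
  proof -
    have B: "B \<in> bounded_operators" "cadjoint B \<in> S" "cadjoint B \<in> bounded_operators"
      using that assms(1,2) by auto
    then have "cadjoint (A o\<^sub>L cadjoint B) = cadjoint (cadjoint B o\<^sub>L A)"
      using assms(3) by (simp add: commutant_def)
    then show ?thesis
      using A B by (simp add: cadjoint_compose cadjoint_cadjoint)
  qed
  then show ?thesis
    using A by (simp add: commutant_def cadjoint_in_bounded_operators)
qed

text \<open>The bicommutant gives a commutative \<open>C\<^sup>*\<close>-algebra around a commuting self-adjoint family
  without any description of its elements: all the closure properties hold for every commutant of a
  self-adjoint set, and commutativity follows from \<open>S'' \<subseteq> S'\<close>, which is \<open>S \<subseteq> S'\<close> with the inclusion
  reversed by taking commutants.\<close>

lemma commutative_cstar_subalgebra_bicommutant: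
  fixes S :: "('h::chilbert_space \<Rightarrow>\<^sub>L 'h) set"
  assumes S: "S \<subseteq> bounded_operators" "cadjoint ` S \<subseteq> S"
    and comm: "\<And>A B. A \<in> S \<Longrightarrow> B \<in> S \<Longrightarrow> A o\<^sub>L B = B o\<^sub>L A"
  shows "commutative_cstar_subalgebra (commutant (commutant S))"
proof -
  have T: "commutant S \<subseteq> bounded_operators" "cadjoint ` commutant S \<subseteq> commutant S"
    using cadjoint_commutant[OF S] by (auto simp: commutant_def)
  have "S \<subseteq> commutant S"
    using S(1) comm by (auto simp: commutant_def)
  then have "commutant (commutant S) \<subseteq> commutant S"
    unfolding commutant_def by blast
  then have "A o\<^sub>L B = B o\<^sub>L A"
    if "A \<in> commutant (commutant S)" "B \<in> commutant (commutant S)" for A B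
    using that unfolding commutant_def by blast
  then show ?thesis
    unfolding commutative_cstar_subalgebra_def
    by (intro conjI ballI commutant_subset csubspace_commutant[OF T(1)] closed_commutant)
      (rule compose_commutant cadjoint_commutant[OF T], assumption+)+
qed
section \<open>Orthogonal projections\<close>

lemma bounded_bilinear_cinner:
  "bounded_bilinear (cinner :: 'h::complex_inner \<Rightarrow> 'h \<Rightarrow> complex)"
proof
  fix x y :: 'h
  show "\<exists>K. \<forall>(x :: 'h) y. norm (cinner x y) \<le> norm x * norm y * K"
  proof (intro exI[of _ 2] allI)
    fix x y :: 'h
    have "cmod (cinner x y) \<le> \<bar>Re (cinner x y)\<bar> + \<bar>Im (cinner x y)\<bar>" by (rule cmod_le)
    also have "\<dots> \<le> norm x * norm y + norm (\<i> *\<^sub>C x) * norm y"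
      unfolding Re_cinner Im_cinner abs_minus_cancel
      by (intro add_mono Cauchy_Schwarz_ineq2)
    finally show "norm (cinner x y) \<le> norm x * norm y * 2"
      by (simp add: norm_scaleC)
  qed
qed (simp_all add: cinner_add_left cinner_add_right scaleR_scaleC cinner_scaleC_left
    cinner_scaleC_right scaleR_conv_of_real)

interpretation cinner: bounded_bilinear "cinner :: 'h::complex_inner \<Rightarrow> 'h \<Rightarrow> complex"
  by (rule bounded_bilinear_cinner)

lemma cinner_eq_0_commute: "cinner x y = 0 \<longleftrightarrow> cinner y x = 0"
  using cinner_commute[of x y] by (simp add: complex_cnj_zero_iff)

lemma cinner_self_eq_0 [simp]: "cinner x x = 0 \<longleftrightarrow> x = 0"
  by (simp add: cinner_self)

text \<open>The component in \<open>M\<close> is the point of \<open>M\<close> closest to \<open>x\<close>. A minimizing sequence is Cauchy by the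
  parallelogram law, since the midpoint of two of its terms is again in \<open>M\<close>.\<close>

lemma orthogonal_decomposition:
  fixes M :: "'h::chilbert_space set"
  assumes "closed M" and M: "csubspace M"
  shows "\<exists>p\<in>M. \<forall>m\<in>M. cinner (x - p) m = 0"
proof -
  have M0: "0 \<in> M" and add: "\<And>m n. m \<in> M \<Longrightarrow> n \<in> M \<Longrightarrow> m + n \<in> M"
    and scale: "\<And>c m. m \<in> M \<Longrightarrow> c *\<^sub>C m \<in> M"
    using M by (auto simp: complex_vector.subspace_def)
  have "convex M"
    by (auto intro!: convexI add scale simp: scaleR_scaleC)
  define d where "d = (INF m\<in>M. (norm (x - m))\<^sup>2)"
  have bdd: "bdd_below ((\<lambda>m. (norm (x - m))\<^sup>2) ` M)" by (rule bdd_belowI2[of _ 0]) simp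
  have d_le: "d \<le> (norm (x - m))\<^sup>2" if "m \<in> M" for m
    unfolding d_def using bdd that by (rule cINF_lower)
  have "\<exists>m\<in>M. (norm (x - m))\<^sup>2 < d + 1 / Suc n" for n
    using cINF_less_iff[of M "\<lambda>m. (norm (x - m))\<^sup>2" "d + 1 / Suc n"] M0 bdd
    unfolding d_def by auto
  then obtain X where XM: "\<And>n. X n \<in> M" and Xd: "\<And>n. (norm (x - X n))\<^sup>2 < d + 1 / Suc n"
    by metis
  have dist: "(norm (m - n))\<^sup>2 \<le> 2 * (norm (x - m))\<^sup>2 + 2 * (norm (x - n))\<^sup>2 - 4 * d"
    if "m \<in> M" "n \<in> M" for m n
  proof -
    have "(1/2) *\<^sub>R (m + n) \<in> M"
      using that by (simp add: scaleR_scaleC add scale)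
    from d_le[OF this] have "4 * d \<le> (norm (2 *\<^sub>R (x - (1/2) *\<^sub>R (m + n))))\<^sup>2"
      by (simp add: power_mult_distrib)
    also have "2 *\<^sub>R (x - (1/2) *\<^sub>R (m + n)) = (x - m) + (x - n)"
      by (simp add: algebra_simps scaleR_2)
    finally show ?thesis
      by (simp add: power2_norm_eq_inner inner_add inner_diff inner_commute)
  qed
  have "Cauchy X"
  proof (rule metric_CauchyI)
    fix e :: real assume "e > 0"
    then obtain N where N: "4 / Suc N < e\<^sup>2"
      using reals_Archimedean[of "e\<^sup>2 / 4"] by (auto simp: field_simps)
    have "dist (X m) (X n) < e" if "m \<ge> N" "n \<ge> N" for m n
    proof -
      have le: "1 / Suc k \<le> 1 / Suc N" if "k \<ge> N" for k
        using that by (simp add: frac_le)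
      have "(norm (X m - X n))\<^sup>2 < 4 / Suc N"
        using dist[OF XM[of m] XM[of n]] Xd[of m] Xd[of n] le[OF that(1)] le[OF that(2)] by linarith
      then have "(norm (X m - X n))\<^sup>2 < e\<^sup>2" using N by linarith
      then show ?thesis
        using \<open>e > 0\<close> by (simp add: dist_norm power_less_imp_less_base)
    qed
    then show "\<exists>N. \<forall>m\<ge>N. \<forall>n\<ge>N. dist (X m) (X n) < e" by blast
  qed
  then obtain p where p: "X \<longlonglongrightarrow> p"
    using Cauchy_convergent convergent_def by blast
  have pM: "p \<in> M"
    using closed_sequentially[OF \<open>closed M\<close> _ p] XM by blast
  have "(norm (x - p))\<^sup>2 \<le> d"
  proof (rule LIMSEQ_le)
    show "(\<lambda>n. (norm (x - X n))\<^sup>2) \<longlonglongrightarrow> (norm (x - p))\<^sup>2" by (intro tendsto_intros p)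
    show "(\<lambda>n. d + 1 / Suc n) \<longlonglongrightarrow> d"
      using tendsto_add[OF tendsto_const LIMSEQ_Suc[OF lim_1_over_n]] by simp
  qed (use Xd in \<open>auto intro: less_imp_le\<close>)
  then have "norm (x - p) \<le> norm (x - z)" if "z \<in> M" for z
    using power2_le_imp_le[OF order_trans[OF _ d_le[OF that]] norm_ge_zero] by blast
  then have closest: "\<forall>z\<in>M. dist x p \<le> dist x z"
    by (simp add: dist_norm)
  have nonpos: "inner (x - p) m \<le> 0" if "m \<in> M" for m
    using any_closest_point_dot[OF \<open>convex M\<close> \<open>closed M\<close> pM _ closest, of "p + m"] add pM that
    by simp
  have neg: "- m \<in> M" if "m \<in> M" for m
    using scale[OF that, of "-1"] by (simp add: complex_vector.scale_minus_left[symmetric])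
  \<comment> \<open>Orthogonality for the real inner product suffices: the imaginary part of the complex one is the
    real part at a multiple of \<open>m\<close> by \<open>\<i>\<close>.\<close>
  have real: "inner (x - p) m = 0" if "m \<in> M" for m
    using nonpos[OF that] nonpos[OF neg[OF that]] by simp
  have "cinner (x - p) m = 0" if "m \<in> M" for m
  proof (rule complex_eqI)
    show "Re (cinner (x - p) m) = Re 0"
      using real[OF that] by (simp add: Re_cinner)
    have "Re (cinner (x - p) (\<i> *\<^sub>C m)) = 0"
      using real[OF scale[OF that]] by (simp add: Re_cinner)
    then show "Im (cinner (x - p) m) = Im 0"
      by (simp add: cinner_scaleC_right)
  qed
  with pM show ?thesis by blast
qed

lemma bounded_operatorsI:
  fixes f :: "'h::complex_inner \<Rightarrow> 'h"
  assumes "\<And>x y. f (x + y) = f x + f y" "\<And>c x. f (c *\<^sub>C x) = c *\<^sub>C f x"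
    and "\<And>x. norm (f x) \<le> norm x * K"
  shows "\<exists>A\<in>bounded_operators. \<forall>x. blinfun_apply A x = f x"
proof -
  have "bounded_linear f"
    using assms by (intro bounded_linear_intro[of _ K]) (auto simp: scaleR_scaleC)
  then show ?thesis
    using assms by (intro bexI[of _ "Blinfun f"])
      (auto simp: bounded_linear_Blinfun_apply bounded_operators_def)
qed

lemma orthogonal_projection_exists:
  fixes M :: "'h::chilbert_space set"
  assumes "closed M" and M: "csubspace M"
  shows "\<exists>P\<in>bounded_operators. \<forall>x. P x \<in> M \<and> (\<forall>m\<in>M. cinner (x - P x) m = 0)"
proof -
  note sub = complex_vector.subspace_add[OF M] complex_vector.subspace_diff[OF M]
    complex_vector.subspace_scale[OF M]
  obtain p where p: "\<And>x. p x \<in> M" "\<And>x m. m \<in> M \<Longrightarrow> cinner (x - p x) m = 0"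
    using orthogonal_decomposition[OF assms] by metis
  have uniq: "p x = q" if "q \<in> M" "\<And>m. m \<in> M \<Longrightarrow> cinner (x - q) m = 0" for x q
  proof -
    have "cinner (p x - q) (p x - q) = cinner (x - q) (p x - q) - cinner (x - p x) (p x - q)"
      by (simp add: cinner_diff_left[symmetric])
    also have "\<dots> = 0"
      using that p sub by simp
    finally show ?thesis by simp
  qed
  have "\<exists>A\<in>bounded_operators. \<forall>x. blinfun_apply A x = p x"
  proof (rule bounded_operatorsI)
    fix x y c
    show "p (x + y) = p x + p y"
    proof (rule uniq)
      fix m assume "m \<in> M"
      then show "cinner (x + y - (p x + p y)) m = 0"
        using p(2)[of m x] p(2)[of m y] by (simp add: cinner.diff_left cinner.add_left)
    qed (use p sub in auto)
    show "p (c *\<^sub>C x) = c *\<^sub>C p x"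
    proof (rule uniq)
      fix m assume "m \<in> M"
      then show "cinner (c *\<^sub>C x - c *\<^sub>C p x) m = 0"
        using p(2)[of m x] by (simp add: cinner.diff_left cinner_scaleC_left)
    qed (use p sub in auto)
    have "Re (cinner (x - p x) (p x)) = 0"
      using p by simp
    then have "(norm (p x))\<^sup>2 = inner x (p x)"
      by (simp add: Re_cinner inner_diff_left power2_norm_eq_inner)
    also have "\<dots> \<le> norm x * norm (p x)" by (rule norm_cauchy_schwarz)
    finally show "norm (p x) \<le> norm x * 1"
      by (cases "p x = 0") (auto simp: power2_eq_square)
  qed
  then show ?thesis using p by metis
qed

section \<open>A maximal partial isometry with orthogonal initial and final spaces\<close>

text \<open>A set of pairs that could be part of the graph of a partial isometry whose initial and final spaces
  are orthogonal. The condition concerns only two pairs at a time and does not ask for a closed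
  subspace; hence it passes to unions of chains, while maximal sets turn out to be closed subspaces
  by themselves.\<close>

definition orthogonal_isometry_graph :: "('h::complex_inner \<times> 'h) set \<Rightarrow> bool"
  where "orthogonal_isometry_graph G \<longleftrightarrow>
    (\<forall>x y x' y'. (x, y) \<in> G \<longrightarrow> (x', y') \<in> G \<longrightarrow>
      cinner x x' = cinner y y' \<and> cinner x y' = 0)"

definition maximal_graph :: "('h::complex_inner \<times> 'h) set \<Rightarrow> bool"
  where "maximal_graph G \<longleftrightarrow> orthogonal_isometry_graph G \<and>
    (\<forall>G'. orthogonal_isometry_graph G' \<longrightarrow> G \<subseteq> G' \<longrightarrow> G' = G)"

lemma maximal_graph_exists: "\<exists>G :: ('h::complex_inner \<times> 'h) set. maximal_graph G"
proof -
  have "\<exists>G\<in>Collect orthogonal_isometry_graph.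
    \<forall>X\<in>Collect (orthogonal_isometry_graph :: ('h \<times> 'h) set \<Rightarrow> bool). G \<subseteq> X \<longrightarrow> X = G"
  proof (rule subset_Zorn')
    fix C :: "('h \<times> 'h) set set"
    assume C: "subset.chain (Collect orthogonal_isometry_graph) C"
    have "cinner x x' = cinner y y' \<and> cinner x y' = 0"
      if XY: "X \<in> C" "Y \<in> C" "(x, y) \<in> X" "(x', y') \<in> Y" for X Y x x' y y'
    proof -
      have "X \<subseteq> Y \<or> Y \<subseteq> X"
        using C XY by (auto simp: subset_chain_def)
      then obtain Z where "Z \<in> C" "(x, y) \<in> Z" "(x', y') \<in> Z"
        using XY by blast
      moreover from this have "orthogonal_isometry_graph Z"
        using C by (auto simp: subset_chain_def)
      ultimately show ?thesis
        unfolding orthogonal_isometry_graph_def by blast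
    qed
    then show "\<Union> C \<in> Collect orthogonal_isometry_graph"
      unfolding orthogonal_isometry_graph_def by blast
  qed
  then show ?thesis
    unfolding maximal_graph_def by auto
qed

lemma maximal_graph_converse: "maximal_graph G \<Longrightarrow> maximal_graph (G\<inverse>)"
proof -
  have flip: "orthogonal_isometry_graph (G\<inverse>)"
    if "orthogonal_isometry_graph G" for G :: "('a \<times> 'a) set"
    using that cinner_eq_0_commute unfolding orthogonal_isometry_graph_def converse_iff by metis
  assume G: "maximal_graph G"
  show ?thesis
    unfolding maximal_graph_def
  proof (intro conjI allI impI)
    show "orthogonal_isometry_graph (G\<inverse>)"
      using G flip unfolding maximal_graph_def by blast
  next
    fix G' assume "orthogonal_isometry_graph G'" "G\<inverse> \<subseteq> G'"
    then have "orthogonal_isometry_graph (G'\<inverse>)" "G \<subseteq> G'\<inverse>"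
      using flip by auto
    then have "G'\<inverse> = G"
      using G unfolding maximal_graph_def by blast
    then show "G' = G\<inverse>" by auto
  qed
qed

context
  fixes G :: "('h::chilbert_space \<times> 'h) set"
  assumes G: "maximal_graph G"
begin

lemma graph_cinner:
  assumes "(x, y) \<in> G" "(x', y') \<in> G"
  shows "cinner x x' = cinner y y'" "cinner x y' = 0" "cinner y x' = 0"
proof -
  have *: "cinner a a' = cinner b b' \<and> cinner a b' = 0" if "(a, b) \<in> G" "(a', b') \<in> G" for a b a' b'
    using G that unfolding maximal_graph_def orthogonal_isometry_graph_def by blast
  show "cinner x x' = cinner y y'" "cinner x y' = 0"
    using *[OF assms] by auto
  show "cinner y x' = 0"
    using *[OF assms(2,1)] cinner_eq_0_commute[of y x'] by simp
qed

text \<open>Maximality as a membership test. Its hypotheses are linear in the new pair and stable under limits,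
  apart from the two conditions on the pair alone, so that it yields all linear and topological
  closure properties of the graph.\<close>

lemma graph_memI:
  assumes "cinner u u = cinner v v" "cinner u v = 0"
    and "\<And>x y. (x, y) \<in> G \<Longrightarrow> cinner u x = cinner v y \<and> cinner u y = 0 \<and> cinner v x = 0"
  shows "(u, v) \<in> G"
proof -
  have "cinner x u = cinner y v \<and> cinner y u = 0 \<and> cinner x v = 0" if "(x, y) \<in> G" for x y
    using assms(3)[OF that] cinner_commute[of x u] cinner_commute[of y v]
      cinner_eq_0_commute[of y u] cinner_eq_0_commute[of x v] by simp
  then have "orthogonal_isometry_graph (insert (u, v) G)"
    using assms graph_cinner cinner_eq_0_commute[of u v]
    unfolding orthogonal_isometry_graph_def by auto
  then show ?thesis
    using G unfolding maximal_graph_def by blast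
qed

lemma graph_zero: "(0, 0) \<in> G"
  by (rule graph_memI) (simp_all add: cinner.zero_left cinner.zero_right)

lemma graph_add:
  assumes "(x, y) \<in> G" "(x', y') \<in> G"
  shows "(x + x', y + y') \<in> G"
  by (rule graph_memI)
    (use assms graph_cinner in \<open>simp_all add: cinner_add_left cinner_add_right\<close>)

lemma graph_scaleC:
  assumes "(x, y) \<in> G"
  shows "(c *\<^sub>C x, c *\<^sub>C y) \<in> G"
  by (rule graph_memI)
    (use assms graph_cinner in \<open>simp_all add: cinner_scaleC_left cinner_scaleC_right\<close>)

lemma graph_diff:
  assumes "(x, y) \<in> G" "(x', y') \<in> G"
  shows "(x - x', y - y') \<in> G"
  by (rule graph_memI)
    (use assms graph_cinner in \<open>simp_all add: cinner.diff_left cinner.diff_right\<close>)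

lemma graph_norm: "(x, y) \<in> G \<Longrightarrow> norm x = norm y"
  using graph_cinner(1)[of x y x y] by (simp add: norm_eq_sqrt_cinner)

lemma graph_single_valued: "(x, y) \<in> G \<Longrightarrow> (x, y') \<in> G \<Longrightarrow> y = y'"
  using graph_norm[OF graph_diff[of x y x y']] by simp

lemma csubspace_Domain_graph: "csubspace (Domain G)"
  unfolding complex_vector.subspace_def
  using graph_zero graph_add graph_scaleC by (blast intro: DomainI)

text \<open>The graph is isometric, so convergence of first components forces convergence of the second ones.\<close>

lemma closed_Domain_graph: "closed (Domain G)"
  unfolding closed_sequential_limits
proof (intro allI impI, elim conjE)
  fix u l assume "\<forall>n. u n \<in> Domain G" and u: "u \<longlonglongrightarrow> l"
  then have "\<forall>n. \<exists>y. (u n, y) \<in> G" by auto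
  then obtain v where uv: "\<And>n. (u n, v n) \<in> G" by metis
  have "dist (v m) (v n) = dist (u m) (u n)" for m n
    using graph_norm[OF graph_diff[OF uv uv]] by (simp add: dist_norm)
  then have "Cauchy v"
    using LIMSEQ_imp_Cauchy[OF u] by (simp add: Cauchy_def)
  then obtain k where v: "v \<longlonglongrightarrow> k"
    using Cauchy_convergent convergent_def by blast
  note lim = cinner.tendsto[OF u u] cinner.tendsto[OF v v] cinner.tendsto[OF u v]
  have "(l, k) \<in> G"
  proof (rule graph_memI)
    show "cinner l l = cinner k k"
      using LIMSEQ_unique[OF lim(1)] lim(2) graph_cinner(1)[OF uv uv] by simp
    show "cinner l k = 0"
      using LIMSEQ_unique[OF lim(3)] graph_cinner(2)[OF uv uv] by simp
    fix x y assume xy: "(x, y) \<in> G"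
    note lim' = cinner.tendsto[OF u tendsto_const] cinner.tendsto[OF v tendsto_const]
    show "cinner l x = cinner k y \<and> cinner l y = 0 \<and> cinner k x = 0"
      using LIMSEQ_unique[OF lim'(1)[of x]] lim'(2)[of y] LIMSEQ_unique[OF lim'(1)[of y]]
        LIMSEQ_unique[OF lim'(2)[of x]] graph_cinner[OF uv xy] by simp
  qed
  then show "l \<in> Domain G" by blast
qed

text \<open>The operator \<open>V\<close> is the partial isometry itself, extended by zero to the orthogonal complement of
  its initial space.\<close>

lemma graph_partial_isometry:
  obtains P V where "P \<in> bounded_operators" "V \<in> bounded_operators"
    and "\<And>x. (P x, V x) \<in> G" "\<And>x m. m \<in> Domain G \<Longrightarrow> cinner (x - P x) m = 0"
proof -
  obtain P where P: "P \<in> bounded_operators" "\<And>x. P x \<in> Domain G"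
    "\<And>x m. m \<in> Domain G \<Longrightarrow> cinner (x - P x) m = 0"
    using orthogonal_projection_exists[OF closed_Domain_graph csubspace_Domain_graph] by metis
  have "\<forall>x. \<exists>y. (P x, y) \<in> G" using P(2) by auto
  then obtain v where v: "\<And>x. (P x, v x) \<in> G" by metis
  have "\<exists>V\<in>bounded_operators. \<forall>x. blinfun_apply V x = v x"
  proof (rule bounded_operatorsI)
    fix x y c
    show "v (x + y) = v x + v y"
      using graph_single_valued[OF v[of "x + y"]] graph_add[OF v v, of x y]
      by (simp add: blinfun.add_right)
    show "v (c *\<^sub>C x) = c *\<^sub>C v x"
      using graph_single_valued[OF v[of "c *\<^sub>C x"]] graph_scaleC[OF v, of c x] P(1)
      by (simp add: bounded_operators_def)
    show "norm (v x) \<le> norm x * norm P"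
      using graph_norm[OF v] norm_blinfun[of P x] by (simp add: mult.commute)
  qed
  then show ?thesis
    using that P v by metis
qed

end

lemma cadjoint_orthogonal_projection:
  fixes P :: "'h::chilbert_space \<Rightarrow>\<^sub>L 'h"
  assumes "P \<in> bounded_operators" "\<And>x. P x \<in> M" "\<And>x m. m \<in> M \<Longrightarrow> cinner (x - P x) m = 0"
  shows "cadjoint P = P"
proof (rule cadjoint_eqI)
  fix x y
  have "cinner (P x) (y - P y) = 0" "cinner (x - P x) (P y) = 0"
    using assms(2,3) cinner_eq_0_commute by blast+
  then show "cinner (P x) y = cinner x (P y)"
    by (simp add: cinner.diff_left cinner.diff_right)
qed (rule assms)+

lemma rank_one_operator_exists:
  "\<exists>A\<in>bounded_operators. \<forall>x. blinfun_apply A x = cinner x f *\<^sub>C (e :: 'h::complex_inner)"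
proof -
  obtain K where K: "\<And>x y :: 'h. norm (cinner x y) \<le> norm x * norm y * K"
    using cinner.bounded by blast
  show ?thesis
  proof (rule bounded_operatorsI)
    fix x
    show "norm (cinner x f *\<^sub>C e) \<le> norm x * (norm f * K * norm e)"
      using mult_right_mono[OF K[of x f], of "norm e"] by (simp add: norm_scaleC mult_ac)
  qed (simp_all add: cinner_add_left cinner_scaleC_left scaleC_add_left scaleC_scaleC)
qed

lemma orthogonal_unit_vector_exists:
  fixes e :: "'h::complex_inner"
  assumes "infinite_dimensional TYPE('h)"
  obtains f :: 'h where "norm f = 1" "cinner f e = 0"
proof -
  obtain x where x: "x \<notin> cspan {e}"
    using assms unfolding infinite_dimensional_def by blast
  define y where "y = x - (cinner x e / cinner e e) *\<^sub>C e"
  have "y \<noteq> 0"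
  proof
    assume "y = 0"
    then have "x = (cinner x e / cinner e e) *\<^sub>C e" by (simp add: y_def)
    also have "\<dots> \<in> cspan {e}"
      by (intro complex_vector.span_scale complex_vector.span_base) simp
    finally show False using x by simp
  qed
  moreover have "cinner y e = 0"
    by (cases "e = 0") (simp_all add: y_def cinner.diff_left cinner_scaleC_left cinner.zero_right)
  ultimately show ?thesis
    using that[of "y /\<^sub>R norm y"] by (simp add: cinner.scaleR_left)
qed

section \<open>Projections equivalent to part of their complement\<close>

text \<open>For a projection \<open>P\<close> this is the relation \<open>P \<precsim> I - P\<close> of Murray and von Neumann, with \<open>C\<close> in the role
  of the partial isometry from \<open>I - P\<close> to \<open>P\<close> and \<open>D\<close> in that of its adjoint. Idempotence of \<open>P\<close> is a
  consequence, and the zero operator qualifies.\<close>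

definition embeds_in_complement :: "('h::chilbert_space \<Rightarrow>\<^sub>L 'h) \<Rightarrow> bool"
  where "embeds_in_complement P \<longleftrightarrow> P \<in> bounded_operators \<and> cadjoint P = P \<and>
    (\<exists>C\<in>bounded_operators. \<exists>D\<in>bounded_operators. P o\<^sub>L C = C \<and> C o\<^sub>L P = 0 \<and> C o\<^sub>L D = P)"

lemma embeds_in_complement_idem: "embeds_in_complement P \<Longrightarrow> P o\<^sub>L P = P"
  unfolding embeds_in_complement_def by (metis blinfun_compose_assoc)

lemma embeds_in_complement_rank_one:
  fixes P :: "'h::chilbert_space \<Rightarrow>\<^sub>L 'h"
  assumes "infinite_dimensional TYPE('h)"
    and P: "P \<in> bounded_operators" "\<And>x. P x = cinner x e *\<^sub>C e" and e: "norm e = 1"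
  shows "embeds_in_complement P"
proof -
  obtain f :: 'h where f: "norm f = 1" "cinner f e = 0"
    using orthogonal_unit_vector_exists[OF assms(1)] by blast
  have ef: "cinner e e = 1" "cinner f f = 1" "cinner e f = 0"
    using e f cinner_eq_0_commute by (auto simp: cinner_self)
  obtain C where C: "C \<in> bounded_operators" "\<And>x. blinfun_apply C x = cinner x f *\<^sub>C e"
    using rank_one_operator_exists by blast
  obtain D where D: "D \<in> bounded_operators" "\<And>x. blinfun_apply D x = cinner x e *\<^sub>C f"
    using rank_one_operator_exists by blast
  have "cadjoint P = P"
  proof (rule cadjoint_eqI)
    fix x y
    show "cinner (P x) y = cinner x (P y)"
      using cinner_commute[of e y] by (simp add: P cinner_scaleC_left cinner_scaleC_right)
  qed (rule P)+
  moreover have "P o\<^sub>L C = C" "C o\<^sub>L P = 0" "C o\<^sub>L D = P"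
    by (rule blinfun_eqI; simp add: P C D ef cinner_scaleC_left scaleC_one)+
  ultimately show ?thesis
    unfolding embeds_in_complement_def using P C D by blast
qed

text \<open>The projections \<open>P\<close> and \<open>Q\<close> onto the initial and the final space of a maximal partial isometry are
  equivalent and orthogonal. Were there two orthogonal nonzero vectors in the range of \<open>R\<close>, scaling
  them to equal length would give a pair that extends the graph; so \<open>R\<close> has rank at most one.\<close>

lemma identity_splits:
  assumes "infinite_dimensional TYPE('h::chilbert_space)"
  obtains P Q R :: "'h::chilbert_space \<Rightarrow>\<^sub>L 'h" where
    "embeds_in_complement P" "embeds_in_complement Q" "embeds_in_complement R"
    "Q o\<^sub>L P = 0" "P + Q + R = id_blinfun"
proof -
  obtain G :: "('h \<times> 'h) set" where G: "maximal_graph G"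
    using maximal_graph_exists by blast
  note G' = maximal_graph_converse[OF G]
  obtain P V where P: "P \<in> bounded_operators" "\<And>x m. m \<in> Domain G \<Longrightarrow> cinner (x - P x) m = 0"
    and V: "V \<in> bounded_operators" "\<And>x. (P x, V x) \<in> G"
    using graph_partial_isometry[OF G] by metis
  obtain Q W where Q: "Q \<in> bounded_operators" "\<And>x m. m \<in> Range G \<Longrightarrow> cinner (x - Q x) m = 0"
    and W: "W \<in> bounded_operators" "\<And>x. (W x, Q x) \<in> G"
    using graph_partial_isometry[OF G'] unfolding Domain_converse converse_iff by metis
  have orth: "cinner x y = 0" if "x \<in> Domain G" "y \<in> Range G" for x y
    using that graph_cinner(2)[OF G] by blast
  have PD: "P x \<in> Domain G" "V x \<in> Range G" "W x \<in> Domain G" "Q x \<in> Range G" for x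
    using V(2) W(2) by blast+
  have P_id: "P x = x" if "x \<in> Domain G" for x
  proof -
    have "x - P x \<in> Domain G"
      by (rule complex_vector.subspace_diff[OF csubspace_Domain_graph[OF G] that PD(1)])
    from P(2)[OF this, of x] show ?thesis by simp
  qed
  have Q_id: "Q x = x" if "x \<in> Range G" for x
  proof -
    have "x - Q x \<in> Range G"
      using complex_vector.subspace_diff[OF csubspace_Domain_graph[OF G'], of x "Q x"] that PD(4)
      by simp
    from Q(2)[OF this, of x] show ?thesis by simp
  qed
  have P_0: "P x = 0" if "\<And>m. m \<in> Domain G \<Longrightarrow> cinner x m = 0" for x
    using P(2)[OF PD(1), of x x] that[OF PD(1)] by (simp add: cinner.diff_left)
  have Q_0: "Q x = 0" if "\<And>m. m \<in> Range G \<Longrightarrow> cinner x m = 0" for x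
    using Q(2)[OF PD(4), of x x] that[OF PD(4)] by (simp add: cinner.diff_left)
  have V_eq: "V x = y" if "(x, y) \<in> G" for x y
    using V(2)[of x] that P_id[of x] graph_single_valued[OF G] by (metis DomainI)
  have W_eq: "W y = x" if "(x, y) \<in> G" for x y
    using W(2)[of y] that Q_id[of y] graph_single_valued[OF G'] by (metis RangeI converse_iff)
  have P_Range: "P y = 0" if "y \<in> Range G" for y
    using that orth cinner_eq_0_commute by (blast intro: P_0)
  have Q_Domain: "Q x = 0" if "x \<in> Domain G" for x
    using that orth by (blast intro: Q_0)
  have V_0: "V x = 0" if "P x = 0" for x
    using graph_norm[OF G V(2)[of x]] that by simp
  have W_0: "W x = 0" if "Q x = 0" for x
    using graph_norm[OF G W(2)[of x]] that by simp
  have adj: "cadjoint P = P" "cadjoint Q = Q"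
    using cadjoint_orthogonal_projection[of P "Domain G"]
      cadjoint_orthogonal_projection[of Q "Range G"] P Q PD by blast+
  have "W o\<^sub>L V = P" "V o\<^sub>L W = Q"
    by (rule blinfun_eqI; simp add: W_eq[OF V(2)] V_eq[OF W(2)])+
  moreover have "P o\<^sub>L W = W" "Q o\<^sub>L V = V"
    by (rule blinfun_eqI; simp add: P_id Q_id PD)+
  moreover have "W o\<^sub>L P = 0" "V o\<^sub>L Q = 0"
    by (rule blinfun_eqI; simp add: W_0 V_0 Q_Domain P_Range PD)+
  ultimately have emb: "embeds_in_complement P" "embeds_in_complement Q"
    unfolding embeds_in_complement_def using P Q V W adj by blast+
  have PQ: "P o\<^sub>L Q = 0" "Q o\<^sub>L P = 0"
    by (rule blinfun_eqI; simp add: Q_Domain P_Range PD)+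
  define R where "R = id_blinfun - P - Q"
  have R: "R \<in> bounded_operators" using P Q by (simp add: R_def)
  have R_apply: "R x = x - P x - Q x" for x
    by (simp add: R_def blinfun.diff_left)
  have R_perp: "cinner (R x) m = 0" if "m \<in> Domain G \<or> m \<in> Range G" for x m
  proof -
    have eq: "cinner (R x) m = cinner (x - P x) m - cinner (Q x) m"
      "cinner (R x) m = cinner (x - Q x) m - cinner (P x) m"
      by (simp_all add: R_apply cinner.diff_left)
    from that show ?thesis
    proof
      assume "m \<in> Domain G"
      then show ?thesis
        using P(2)[of m x] orth[OF _ PD(4), of m x] cinner_eq_0_commute[of "Q x" m]
        by (simp add: eq(1))
    next
      assume "m \<in> Range G"
      then show ?thesis
        using Q(2)[of m x] orth[OF PD(1), of m x] by (simp add: eq(2))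
    qed
  qed
  have "embeds_in_complement R"
  proof (cases "R = 0")
    case True
    have "cadjoint 0 = (0 :: 'h \<Rightarrow>\<^sub>L 'h)"
      by (rule cadjoint_eqI) (simp_all add: cinner.zero_left cinner.zero_right)
    then show ?thesis
      unfolding embeds_in_complement_def True by auto
  next
    case False
    then obtain z where z: "R z \<noteq> 0"
      using blinfun_eqI[of R 0] by auto
    define e where "e = R z /\<^sub>R norm (R z)"
    have e: "norm e = 1" using z by (simp add: e_def)
    have e_perp: "cinner e m = 0" if "m \<in> Domain G \<or> m \<in> Range G" for m
      using R_perp[OF that] by (simp add: e_def cinner.scaleR_left)
    have "R x = cinner x e *\<^sub>C e" for x
    proof -
      define r where "r = R x - cinner x e *\<^sub>C e"
      have r_perp: "cinner r m = 0" if "m \<in> Domain G \<or> m \<in> Range G" for m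
        using R_perp[OF that] e_perp[OF that] by (simp add: r_def cinner.diff_left cinner_scaleC_left)
      have "cinner (P x) e = 0" "cinner (Q x) e = 0"
        using e_perp PD cinner_eq_0_commute by blast+
      then have "cinner r e = 0"
        using e by (simp add: r_def R_apply cinner.diff_left cinner_scaleC_left cinner_self)
      \<comment> \<open>The pair lies in the graph by maximality, so \<open>r\<close> is in the final space and also orthogonal to
        it.\<close>
      have "(norm r *\<^sub>R e, r) \<in> G"
      proof (rule graph_memI[OF G])
        show "cinner (norm r *\<^sub>R e) (norm r *\<^sub>R e) = cinner r r"
          using e by (simp add: cinner_self)
        show "cinner (norm r *\<^sub>R e) r = 0"
          using \<open>cinner r e = 0\<close> cinner_eq_0_commute[of r e] by (simp add: cinner.scaleR_left)
        fix x y assume "(x, y) \<in> G"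
        then have "x \<in> Domain G" "y \<in> Range G" by blast+
        then show "cinner (norm r *\<^sub>R e) x = cinner r y \<and> cinner (norm r *\<^sub>R e) y = 0 \<and> cinner r x = 0"
          using e_perp r_perp by (simp add: cinner.scaleR_left)
      qed
      then have "cinner r r = 0"
        using r_perp by blast
      then show ?thesis by (simp add: r_def)
    qed
    then show ?thesis
      using embeds_in_complement_rank_one[OF assms R _ e] by blast
  qed
  with emb PQ show ?thesis
    by (intro that[of P Q R]) (simp_all add: R_def)
qed

section \<open>Additivity from multiplicativity\<close>

locale multiplicative_operator_map =
  fixes \<phi> :: "('h::chilbert_space \<Rightarrow>\<^sub>L 'h) \<Rightarrow> ('h \<Rightarrow>\<^sub>L 'h)"
  assumes mult: "A \<in> bounded_operators \<Longrightarrow> B \<in> bounded_operators \<Longrightarrow> \<phi> (A o\<^sub>L B) = \<phi> A o\<^sub>L \<phi> B"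
    and zero: "\<phi> 0 = 0"
    and unif: "commutative_cstar_subalgebra \<A> \<Longrightarrow> uniformly_continuous_on \<A> \<phi>"
begin

text \<open>Multiplicativity and \<open>\<phi> 0 = 0\<close> make \<open>\<phi> P\<close>, \<open>\<phi> (I - P)\<close> and the defect \<open>Q\<close> mutually orthogonal
  idempotents commuting with the values of \<open>\<phi>\<close> on the span of \<open>P\<close> and \<open>I - P\<close>. Uniform continuity has
  to rule out a nonzero \<open>Q\<close>; continuity alone would not, as the determinant on diagonal matrices
  shows.\<close>

lemma orthogonally_additive:
  assumes P: "P \<in> bounded_operators" "P o\<^sub>L P = P" "cadjoint P = P"
  shows "\<phi> id_blinfun = \<phi> P + \<phi> (id_blinfun - P)"
proof -
  define P' where "P' = id_blinfun - P"
  have P': "P' \<in> bounded_operators" using P by (simp add: P'_def)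
  have PP': "P o\<^sub>L P' = 0" "P' o\<^sub>L P = 0" "P' o\<^sub>L P' = P'"
    using P by (simp_all add: P'_def blinfun_compose.diff_left blinfun_compose.diff_right)
  define a where "a x y = x *\<^sub>R P + y *\<^sub>R P'" for x y
  have a: "a x y \<in> bounded_operators" for x y
    using P P' by (simp add: a_def)
  have a_mult: "a x y o\<^sub>L a u v = a (x * u) (y * v)" for x y u v
    using P(2) PP' by (simp add: a_def blinfun_compose.add_left blinfun_compose.add_right
        blinfun_compose.scaleR_left blinfun_compose.scaleR_right mult.commute)
  have a_units: "a 1 1 = id_blinfun" "a 1 0 = P" "a 0 1 = P'" "a 0 0 = 0"
    by (simp_all add: a_def P'_def)
  define \<A> where "\<A> = commutant (commutant {P})"
  have "uniformly_continuous_on \<A> \<phi>"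
    unfolding \<A>_def
    by (intro unif commutative_cstar_subalgebra_bicommutant) (use P in auto)
  have a_in: "a x y \<in> \<A>" for x y
  proof -
    have "a x y o\<^sub>L B = B o\<^sub>L a x y" if "B o\<^sub>L P = P o\<^sub>L B" for B
      unfolding a_def P'_def using that
      by (simp only: blinfun_compose.add_left blinfun_compose.add_right
          blinfun_compose.scaleR_left blinfun_compose.scaleR_right
          blinfun_compose.diff_left blinfun_compose.diff_right blinfun_compose_id)
    with a show ?thesis
      unfolding \<A>_def commutant_def by simp
  qed
  have \<phi>a: "\<phi> (a x y) o\<^sub>L \<phi> (a u v) = \<phi> (a (x * u) (y * v))" for x y u v
    by (simp add: mult[OF a a, symmetric] a_mult)
  define Q where "Q = \<phi> (a 1 1) - \<phi> (a 1 0) - \<phi> (a 0 1)"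
  have Q_left: "Q o\<^sub>L \<phi> (a x y) = \<phi> (a x y) - \<phi> (a x 0) - \<phi> (a 0 y)" for x y
    by (simp add: Q_def blinfun_compose.diff_left \<phi>a)
  have Q_commute: "\<phi> (a x y) o\<^sub>L Q = Q o\<^sub>L \<phi> (a x y)" for x y
    by (simp add: Q_left) (simp add: Q_def blinfun_compose.diff_right \<phi>a)
  have Q_idem: "Q o\<^sub>L Q = Q"
  proof -
    have "Q o\<^sub>L Q = (Q o\<^sub>L \<phi> (a 1 1)) - (Q o\<^sub>L \<phi> (a 1 0)) - (Q o\<^sub>L \<phi> (a 0 1))"
      by (subst (2) Q_def) (simp add: blinfun_compose.diff_right)
    also have "\<dots> = Q"
      unfolding Q_left by (simp add: Q_def a_units zero)
    finally show ?thesis .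
  qed
  have est: "norm Q \<le> (norm Q * e)\<^sup>2" if "e > 0" for e
  proof -
    obtain d where d: "d > 0"
      and uc: "\<And>A B. A \<in> \<A> \<Longrightarrow> B \<in> \<A> \<Longrightarrow> norm (A - B) < d \<Longrightarrow> norm (\<phi> A - \<phi> B) < e"
      using \<open>uniformly_continuous_on \<A> \<phi>\<close> \<open>e > 0\<close>
      unfolding uniformly_continuous_on_def dist_norm by metis
    \<comment> \<open>Changing one coefficient from \<open>0\<close> to \<open>t\<close> moves the operator by less than \<open>d\<close>.\<close>
    define t where "t = d / (1 + norm P + norm P')"
    have pos: "1 + norm P + norm P' > 0"
      by (simp add: add_pos_nonneg)
    then have t: "t > 0" using d by (simp add: t_def)
    have "t * norm P < t * (1 + norm P + norm P')" "t * norm P' < t * (1 + norm P + norm P')"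
      using t by (auto intro!: mult_strict_left_mono simp: add_pos_nonneg add_nonneg_pos)
    moreover have "t * (1 + norm P + norm P') = d"
      using pos by (simp add: t_def)
    ultimately have tP: "t * norm P < d" "t * norm P' < d"
      by simp_all
    have 1: "norm (Q o\<^sub>L \<phi> (a x t)) \<le> norm Q * e" for x
    proof -
      have "Q o\<^sub>L \<phi> (a x t) = Q o\<^sub>L (\<phi> (a x t) - \<phi> (a x 0))"
        by (simp add: blinfun_compose.diff_right Q_left a_units zero)
      also have "norm \<dots> \<le> norm Q * norm (\<phi> (a x t) - \<phi> (a x 0))"
        by (rule norm_blinfun_compose)
      also have "norm (\<phi> (a x t) - \<phi> (a x 0)) \<le> e"
        using t tP by (intro less_imp_le uc a_in) (simp add: a_def)
      finally show ?thesis by (simp add: mult_left_mono)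
    qed
    have 2: "norm (Q o\<^sub>L \<phi> (a t y)) \<le> norm Q * e" for y
    proof -
      have "Q o\<^sub>L \<phi> (a t y) = Q o\<^sub>L (\<phi> (a t y) - \<phi> (a 0 y))"
        by (simp add: blinfun_compose.diff_right Q_left a_units zero)
      also have "norm \<dots> \<le> norm Q * norm (\<phi> (a t y) - \<phi> (a 0 y))"
        by (rule norm_blinfun_compose)
      also have "norm (\<phi> (a t y) - \<phi> (a 0 y)) \<le> e"
        using t tP by (intro less_imp_le uc a_in) (simp add: a_def)
      finally show ?thesis by (simp add: mult_left_mono)
    qed
    have "(Q o\<^sub>L \<phi> (a t (1 / t))) o\<^sub>L (Q o\<^sub>L \<phi> (a (1 / t) t))
        = Q o\<^sub>L (\<phi> (a t (1 / t)) o\<^sub>L Q) o\<^sub>L \<phi> (a (1 / t) t)"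
      by (simp only: blinfun_compose_assoc)
    also have "\<dots> = (Q o\<^sub>L Q) o\<^sub>L (\<phi> (a t (1 / t)) o\<^sub>L \<phi> (a (1 / t) t))"
      by (simp only: blinfun_compose_assoc Q_commute)
    also have "\<dots> = Q o\<^sub>L \<phi> (a 1 1)"
      using t by (simp add: Q_idem \<phi>a)
    also have "\<dots> = Q"
      by (simp only: Q_left) (simp add: Q_def)
    finally have "norm Q = norm ((Q o\<^sub>L \<phi> (a t (1 / t))) o\<^sub>L (Q o\<^sub>L \<phi> (a (1 / t) t)))"
      by simp
    also have "\<dots> \<le> norm (Q o\<^sub>L \<phi> (a t (1 / t))) * norm (Q o\<^sub>L \<phi> (a (1 / t) t))"
      by (rule norm_blinfun_compose)
    also have "\<dots> \<le> (norm Q * e) * (norm Q * e)"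
      using \<open>e > 0\<close> by (intro mult_mono[OF 2 1]) simp_all
    finally show ?thesis by (simp add: power2_eq_square)
  qed
  have "norm Q = 0"
  proof (rule ccontr)
    assume "norm Q \<noteq> 0"
    then have q: "norm Q > 0" by simp
    have "norm Q \<le> (norm Q * (1 / (2 * norm Q)))\<^sup>2"
      using q by (intro est) simp
    also have "norm Q * (1 / (2 * norm Q)) = 1 / 2"
      using q by simp
    finally have "norm Q < 1"
      by (simp add: power2_eq_square)
    then have "norm Q * norm Q < norm Q * 1"
      using q by (intro mult_strict_left_mono)
    then show False
      using est[of 1] by (simp add: power2_eq_square)
  qed
  then have "Q = 0" by simp
  then have "\<phi> id_blinfun - \<phi> P - \<phi> P' = 0"
    by (simp only: Q_def a_units)
  then show ?thesis
    unfolding P'_def by (metis diff_diff_eq eq_iff_diff_eq_0)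
qed

lemma split_left:
  assumes P: "P \<in> bounded_operators" "P o\<^sub>L P = P" "cadjoint P = P" and A: "A \<in> bounded_operators"
  shows "\<phi> A = \<phi> (P o\<^sub>L A) + \<phi> ((id_blinfun - P) o\<^sub>L A)"
proof -
  have "\<phi> A = \<phi> id_blinfun o\<^sub>L \<phi> A"
    using A by (simp add: mult[symmetric])
  then show ?thesis
    using A P by (simp add: orthogonally_additive[OF P] blinfun_compose.add_left mult)
qed

lemma split_right:
  assumes P: "P \<in> bounded_operators" "P o\<^sub>L P = P" "cadjoint P = P" and A: "A \<in> bounded_operators"
  shows "\<phi> A = \<phi> (A o\<^sub>L P) + \<phi> (A o\<^sub>L (id_blinfun - P))"
proof -
  have "\<phi> A = \<phi> A o\<^sub>L \<phi> id_blinfun"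
    using A by (simp add: mult[symmetric])
  then show ?thesis
    using A P by (simp add: orthogonally_additive[OF P] blinfun_compose.add_right mult)
qed

text \<open>Both factors of \<open>A + B = (P + A) ((I - P) + B)\<close> are sums over different corners, where additivity is
  already known; the remaining products vanish since \<open>A B = 0\<close> and \<open>P (I - P) = 0\<close>.\<close>

lemma additive_off_diagonal:
  assumes P: "P \<in> bounded_operators" "P o\<^sub>L P = P" "cadjoint P = P"
    and A: "A \<in> bounded_operators" "P o\<^sub>L A = A" "A o\<^sub>L P = 0"
    and B: "B \<in> bounded_operators" "P o\<^sub>L B = B" "B o\<^sub>L P = 0"
  shows "\<phi> (A + B) = \<phi> A + \<phi> B"
proof -
  define P' where "P' = id_blinfun - P"
  have P': "P' \<in> bounded_operators" "P o\<^sub>L P' = 0" "P' o\<^sub>L P = 0" "P' o\<^sub>L P' = P'"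
    "A o\<^sub>L P' = A" "P' o\<^sub>L B = 0"
    using P A B by (simp_all add: P'_def blinfun_compose.diff_left blinfun_compose.diff_right)
  have AB: "A o\<^sub>L B = 0"
    by (metis A(3) B(2) blinfun_compose_assoc blinfun_compose.zero_left)
  have "\<phi> (P + A) = \<phi> P + \<phi> A"
    using split_right[OF P, of "P + A"] P A P' by (simp add: P'_def[symmetric] blinfun_compose.add_left)
  moreover have "\<phi> (P' + B) = \<phi> B + \<phi> P'"
    using split_left[OF P, of "P' + B"] B P' by (simp add: P'_def[symmetric] blinfun_compose.add_right)
  moreover have "A + B = (P + A) o\<^sub>L (P' + B)"
    using P A B P' AB by (simp add: blinfun_compose.add_left blinfun_compose.add_right)
  ultimately have "\<phi> (A + B) = (\<phi> P + \<phi> A) o\<^sub>L (\<phi> B + \<phi> P')"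
    using P A B P' by (simp add: mult)
  then show ?thesis
    using P A B P' AB
    by (simp add: blinfun_compose.add_left blinfun_compose.add_right mult[symmetric] zero)
qed

text \<open>The diagonal part \<open>P A P = (P A C) D\<close> factors through the off-diagonal element \<open>P A C\<close>, in which
  \<open>\<phi>\<close> is additive in \<open>A\<close>.\<close>

lemma additive_corner:
  assumes P: "P \<in> bounded_operators" "cadjoint P = P"
    and C: "C \<in> bounded_operators" "P o\<^sub>L C = C" "C o\<^sub>L P = 0"
    and D: "D \<in> bounded_operators" "C o\<^sub>L D = P"
    and A: "A \<in> bounded_operators" and B: "B \<in> bounded_operators"
  shows "\<phi> (P o\<^sub>L (A + B)) = \<phi> (P o\<^sub>L A) + \<phi> (P o\<^sub>L B)"
proof -
  have PP: "P o\<^sub>L P = P" using C D by (metis blinfun_compose_assoc)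
  note P = P(1) PP P(2)
  define P' where "P' = id_blinfun - P"
  have P': "P' \<in> bounded_operators" "P' o\<^sub>L P = 0"
    using P by (simp_all add: P'_def blinfun_compose.diff_left)
  have off: "\<phi> (P o\<^sub>L (A + B) o\<^sub>L X) = \<phi> (P o\<^sub>L A o\<^sub>L X) + \<phi> (P o\<^sub>L B o\<^sub>L X)"
    if "X \<in> bounded_operators" "X o\<^sub>L P = 0" for X
    unfolding blinfun_compose.add_left blinfun_compose.add_right
    by (rule additive_off_diagonal[OF P])
      (use P A B that in \<open>simp_all add: blinfun_compose_assoc, simp_all add: blinfun_compose_assoc[symmetric]\<close>)
  have "\<phi> (P o\<^sub>L Z) = (\<phi> (P o\<^sub>L Z o\<^sub>L C) o\<^sub>L \<phi> D) + \<phi> (P o\<^sub>L Z o\<^sub>L P')" if "Z \<in> bounded_operators" for Z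
  proof -
    have "\<phi> (P o\<^sub>L Z o\<^sub>L C) o\<^sub>L \<phi> D = \<phi> (P o\<^sub>L Z o\<^sub>L P)"
      using P C D that mult[of "P o\<^sub>L Z o\<^sub>L C" D] by (simp add: blinfun_compose_assoc)
    then show ?thesis
      using split_right[OF P, of "P o\<^sub>L Z"] P that by (simp add: P'_def)
  qed
  then show ?thesis
    using off[OF C(1,3)] off[OF P'] A B by (simp add: blinfun_compose.add_left)
qed

end

theorem mainTheorem2:
  fixes \<phi> :: "('h::chilbert_space \<Rightarrow>\<^sub>L 'h) \<Rightarrow> ('h \<Rightarrow>\<^sub>L 'h)"
  assumes "separable_space (euclidean :: 'h topology)"
    and "infinite_dimensional TYPE('h)"
    and "star_semigroup_endomorphism \<phi>"
    and "\<And>\<A>. commutative_cstar_subalgebra \<A> \<Longrightarrow> uniformly_continuous_on \<A> \<phi>"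
    and "\<phi> 0 = 0"
  shows "\<forall>A \<in> bounded_operators. \<forall>B \<in> bounded_operators. \<phi> (A + B) = \<phi> A + \<phi> B"
proof (intro ballI)
  interpret multiplicative_operator_map \<phi>
    using assms(3-5) by unfold_locales (auto simp: star_semigroup_endomorphism_def)
  obtain P Q R :: "'h \<Rightarrow>\<^sub>L 'h" where
    emb: "embeds_in_complement P" "embeds_in_complement Q" "embeds_in_complement R"
    and QP: "Q o\<^sub>L P = 0" and sum: "P + Q + R = id_blinfun"
    using identity_splits[OF assms(2)] by blast
  have bdd: "P \<in> bounded_operators" "Q \<in> bounded_operators" "R \<in> bounded_operators"
    using emb by (auto simp: embeds_in_complement_def)
  have P: "P \<in> bounded_operators" "P o\<^sub>L P = P" "cadjoint P = P"
    and Q: "Q \<in> bounded_operators" "Q o\<^sub>L Q = Q" "cadjoint Q = Q"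
    using emb embeds_in_complement_idem by (auto simp: embeds_in_complement_def)
  have R: "R = id_blinfun - P - Q"
    using sum by (metis add_diff_cancel_left' diff_diff_add)
  have split: "\<phi> X = \<phi> (P o\<^sub>L X) + \<phi> (Q o\<^sub>L X) + \<phi> (R o\<^sub>L X)" if X: "X \<in> bounded_operators" for X
  proof -
    define Y where "Y = (id_blinfun - P) o\<^sub>L X"
    have "Y \<in> bounded_operators" using P X by (simp add: Y_def)
    moreover have QY: "Q o\<^sub>L Y = Q o\<^sub>L X"
      using QP by (simp add: Y_def blinfun_compose_assoc[symmetric] blinfun_compose.diff_right)
    moreover have "(id_blinfun - Q) o\<^sub>L Y = R o\<^sub>L X"
      unfolding blinfun_compose.diff_left QY by (simp add: Y_def R blinfun_compose.diff_left)
    ultimately have "\<phi> Y = \<phi> (Q o\<^sub>L X) + \<phi> (R o\<^sub>L X)"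
      using split_left[OF Q] by metis
    then show ?thesis
      using split_left[OF P X] by (simp add: Y_def)
  qed
  fix A B :: "'h \<Rightarrow>\<^sub>L 'h"
  assume A: "A \<in> bounded_operators" and B: "B \<in> bounded_operators"
  have corner: "\<phi> (E o\<^sub>L (A + B)) = \<phi> (E o\<^sub>L A) + \<phi> (E o\<^sub>L B)" if "embeds_in_complement E" for E
    using that additive_corner A B unfolding embeds_in_complement_def by blast
  show "\<phi> (A + B) = \<phi> A + \<phi> B"
    using A B by (simp add: split[of "A + B"] split[of A] split[of B] emb[THEN corner])
qed

end
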